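(* Let $q,n\ge1$ and let $\mathbf f_n(z)=A_0z^n+A_1z^{n-1}+\cdots+A_n$ with $A_0=I_q$, $A_j\in\mathbb C^{q\times q}$, be a Hurwitz-type matrix polynomial with Markov parameters $(s_j)_{j\ge0}$, where $s_0,\dots,s_{n-1}$ is a Stieltjes positive sequence. Let $P_{k,m},Q_{k,m}$ ($k=1,2$) be the matrix polynomials defined in the context from these Markov parameters, and suppose that $\mathbf f_n$ admits the representation $$\mathbf f_n(z)=\begin{cases}(-1)^m\bigl(P_{1,m}^*(-\bar z^2)-z\,Q_{1,m}^*(-\bar z^2)\bigr),& n=2m,\\ (-1)^m\bigl(Q_{2,m}^*(-\bar z^2)+z\,P_{2,m}^*(-\bar z^2)\bigr),& n=2m+1.\end{cases}$$ Then the following identities hold. If $n=2m$, $m\ge1$, then $$A_{n-k}=\begin{cases}\dfrac{(-1)^{m+j}}{j!}\,(P_{1,m}^* )^{(j)}(0),& k=2j,\ 0\le j\le m,\\[2ex] -\dfrac{(-1)^{m+j}}{j!}\,(Q_{1,m}^* )^{(j)}(0),& k=2j+1,\ 0\le j\le m-1.\end{cases}$$ If $n=2m+1$, $m\ge0$, then $$A_{n-k}=\begin{cases}\dfrac{(-1)^{m+j}}{j!}\,(Q_{2,m}^* )^{(j)}(0),& k=2j,\ 0\le j\le m,\\[2ex] \dfrac{(-1)^{m+j}}{j!}\,(P_{2,m}^* )^{(j)}(0),& k=2j+1,\ 0\le j\le m.\end{cases}$$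
   Context: **Notation.** For a matrix polynomial $F$, $F^*(w):=(F(w))^*$ (conjugate transpose), so that $z\mapsto F^*(-\bar z^2)=(F(-\bar z^2))^*$ is a polynomial in $z$; $(F^* )^{(j)}(0)$ denotes $(F^{(j)}(0))^*$. **Hurwitz-type matrix (HTM) polynomials.** Write $\mathbf f_n(z)=\mathbf h_n(z^2)+z\,\mathbf g_n(z^2)$, where for $n=2m$: $\mathbf h_n(z)=I_qz^m+A_2z^{m-1}+\cdots+A_{2m}$, $\mathbf g_n(z)=A_1z^{m-1}+A_3z^{m-2}+\cdots+A_{2m-1}$; and for $n=2m+1$: $\mathbf h_n(z)=A_1z^m+A_3z^{m-1}+\cdots+A_{2m+1}$, $\mathbf g_n(z)=I_qz^m+A_2z^{m-1}+\cdots+A_{2m}$. $\mathbf f_n$ is an HTM polynomial if there are Hermitian positive definite $q\times q$ matrices $\mathbf c_0,\dots,\mathbf c_{m-1},\mathbf d_0,\dots,\mathbf d_{m-1}$ if $n=2m$ (resp. $\mathbf c_0,\dots,\mathbf c_m,\mathbf d_0,\dots,\mathbf d_{m-1}$ if $n=2m+1$) such that, as an identity of rational matrix functions, $\mathbf g_n(z)\mathbf h_n(z)^{-1}=K_0(z)$ (resp. $\mathbf h_n(z)(z\mathbf g_n(z))^{-1}=K_0(z)$), where $K_{m-1}(z)=(z\mathbf c_{m-1}+\mathbf d_{m-1}^{-1})^{-1}$ and $K_i(z)=\bigl(z\mathbf c_i+(\mathbf d_i+K_{i+1}(z))^{-1}\bigr)^{-1}$ for $i=m-2,\dots,0$ (resp.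 $K_m(z)=z^{-1}\mathbf c_m^{-1}$ and $K_i(z)=\bigl(z\mathbf c_i+(\mathbf d_i+K_{i+1}(z))^{-1}\bigr)^{-1}$ for $i=m-1,\dots,0$). **Markov parameters.** The Markov parameters $s_j\in\mathbb C^{q\times q}$ of $\mathbf f_n$ are defined by the Laurent expansion at infinity $\sum_{j\ge0}(-1)^js_jz^{-j-1}$ of $\mathbf g_n(z)\mathbf h_n(z)^{-1}$ if $n=2m$, resp. of $\mathbf h_n(z)(z\mathbf g_n(z))^{-1}$ if $n=2m+1$. **Block Hankel matrices.** $H_{1,j}=(s_{a+b})_{a,b=0}^{j}$, $H_{2,j}=(s_{a+b+1})_{a,b=0}^{j}$. A sequence $(s_j)_{j=0}^{\kappa}$ is Stieltjes positive if $H_{1,j}$ is Hermitian positive definite whenever $2j\le\kappa$ and $H_{2,j}$ is Hermitian positive definite whenever $2j+1\le\kappa$. Put $y_{[j,k]}=(s_j,s_{j+1},\dots,s_k)^*$ (block column), and for $j\ge1$: $Y_{1,j}=y_{[j,2j-1]}$, $Y_{2,j}=y_{[j+1,2j]}$. **Matrix polynomials.** For $j\ge1$ let $T_j=\begin{pmatrix}0_{q\times jq}&0_q\\ I_{jq}&0_{jq\times q}\end{pmatrix}$, $R_j(z)=(I_{(j+1)q}-zT_j)^{-1}$, $v_j=\begin{pmatrix}I_q\\0_{jq\times q}\end{pmatrix}$, $u_{1,j}=\begin{pmatrix}0_q\\-y_{[0,j-1]}\end{pmatrix}$, $u_{2,j}=-y_{[0,j]}$. Set $P_{1,0}(z)=I_q$,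 $Q_{1,0}(z)=0_q$, $P_{2,0}(z)=I_q$, $Q_{2,0}(z)=s_0$, and for $j\ge1$, $r=1,2$: $P_{r,j}(z)=(-Y_{r,j}^*H_{r,j-1}^{-1},\,I_q)R_j(z)v_j$, $Q_{r,j}(z)=-(-Y_{r,j}^*H_{r,j-1}^{-1},\,I_q)R_j(z)u_{r,j}$. *)

theory Defs
  imports
    "HOL-Analysis.Derivative"
    "Jordan_Normal_Form.Schur_Decomposition"
    "Jordan_Normal_Form.Gauss_Jordan_Elimination"
begin

text \<open>Matrix polynomials and rational matrix functions are represented by the functions
  \<open>complex \<Rightarrow> complex mat\<close> they induce; \<open>q\<close> is always the size of the (square) values.\<close>

text \<open>\<open>mat_inverse\<close> returns an option; the result below is meaningful only for invertible \<open>A\<close>.\<close>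

abbreviation minv :: "complex mat \<Rightarrow> complex mat" where
  "minv A \<equiv> the (mat_inverse A)"

definition hermitian_pos_def :: "nat \<Rightarrow> complex mat \<Rightarrow> bool" where
  "hermitian_pos_def k A \<longleftrightarrow> A \<in> carrier_mat k k \<and> mat_adjoint A = A \<and>
     (\<forall>v \<in> carrier_vec k. v \<noteq> 0\<^sub>v k \<longrightarrow> 0 < (A *\<^sub>v v) \<bullet>c v)"

text \<open>\<open>A 0 z^d + A 1 z^(d-1) + \<dots> + A d\<close>: coefficients are listed from the leading one downwards.\<close>

definition matpoly :: "nat \<Rightarrow> nat \<Rightarrow> (nat \<Rightarrow> complex mat) \<Rightarrow> complex \<Rightarrow> complex mat" where
  "matpoly q d A z = mat q q (\<lambda>(a, b). \<Sum>i\<le>d. A i $$ (a, b) * z ^ (d - i))"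

definition matderiv :: "nat \<Rightarrow> nat \<Rightarrow> (complex \<Rightarrow> complex mat) \<Rightarrow> complex \<Rightarrow> complex mat" where
  "matderiv q j F w = mat q q (\<lambda>(a, b). (deriv ^^ j) (\<lambda>z. F z $$ (a, b)) w)"


subsection \<open>Hurwitz-type matrix polynomials and Markov parameters\<close>

text \<open>The polynomials in \<open>f(z) = h(z^2) + z g(z^2)\<close>, where \<open>f = matpoly q n A\<close>.\<close>

definition h_part :: "nat \<Rightarrow> nat \<Rightarrow> (nat \<Rightarrow> complex mat) \<Rightarrow> complex \<Rightarrow> complex mat" where
  "h_part q n A = (if even n then matpoly q (n div 2) (\<lambda>i. A (2 * i))
                   else matpoly q (n div 2) (\<lambda>i. A (2 * i + 1)))"

definition g_part :: "nat \<Rightarrow> nat \<Rightarrow> (nat \<Rightarrow> complex mat) \<Rightarrow> complex \<Rightarrow> complex mat" where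
  "g_part q n A = (if even n then matpoly q (n div 2 - 1) (\<lambda>i. A (2 * i + 1))
                   else matpoly q (n div 2) (\<lambda>i. A (2 * i)))"

definition transfer_fun :: "nat \<Rightarrow> nat \<Rightarrow> (nat \<Rightarrow> complex mat) \<Rightarrow> complex \<Rightarrow> complex mat" where
  "transfer_fun q n A z = (if even n then g_part q n A z * minv (h_part q n A z)
                           else h_part q n A z * minv (z \<cdot>\<^sub>m g_part q n A z))"

function K_even :: "nat \<Rightarrow> (nat \<Rightarrow> complex mat) \<Rightarrow> (nat \<Rightarrow> complex mat) \<Rightarrow> nat \<Rightarrow> complex \<Rightarrow> complex mat" where
  "K_even m c d i z = (if i + 1 < m
     then minv (z \<cdot>\<^sub>m c i + minv (d i + K_even m c d (i + 1) z))
     else minv (z \<cdot>\<^sub>m c i + minv (d i)))"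
  by pat_completeness auto
termination by (relation "measure (\<lambda>(m, c, d, i, z). m - i)") auto

function K_odd :: "nat \<Rightarrow> (nat \<Rightarrow> complex mat) \<Rightarrow> (nat \<Rightarrow> complex mat) \<Rightarrow> nat \<Rightarrow> complex \<Rightarrow> complex mat" where
  "K_odd m c d i z = (if i < m
     then minv (z \<cdot>\<^sub>m c i + minv (d i + K_odd m c d (i + 1) z))
     else inverse z \<cdot>\<^sub>m minv (c i))"
  by pat_completeness auto
termination by (relation "measure (\<lambda>(m, c, d, i, z). m - i)") auto

declare K_even.simps [simp del] K_odd.simps [simp del]

text \<open>Equality of rational matrix functions is equality at all but finitely many points. All
  matrices inverted here are invertible as rational functions, so only finitely many \<open>z\<close>
  are affected by the unspecified values of \<open>minv\<close>.\<close>

definition htm_polynomial :: "nat \<Rightarrow> nat \<Rightarrow> (nat \<Rightarrow> complex mat) \<Rightarrow> bool" where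
  "htm_polynomial q n A \<longleftrightarrow> (let m = n div 2 in
     \<exists>c d. (\<forall>i < (if even n then m else m + 1). hermitian_pos_def q (c i)) \<and>
           (\<forall>i < m. hermitian_pos_def q (d i)) \<and>
           (\<forall>\<^sub>\<infinity>z. transfer_fun q n A z =
              (if even n then K_even m c d 0 z else K_odd m c d 0 z)))"

definition markov_parameters :: "nat \<Rightarrow> nat \<Rightarrow> (nat \<Rightarrow> complex mat) \<Rightarrow> (nat \<Rightarrow> complex mat) \<Rightarrow> bool" where
  "markov_parameters q n A s \<longleftrightarrow> (\<forall>j. s j \<in> carrier_mat q q) \<and>
     (\<forall>\<^sub>F z in at_infinity. \<forall>a<q. \<forall>b<q.
        (\<lambda>j. (-1) ^ j * s j $$ (a, b) / z ^ (j + 1)) sums (transfer_fun q n A z $$ (a, b)))"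


subsection \<open>Block Hankel matrices\<close>

text \<open>The \<open>r \<times> c\<close> block matrix with \<open>q \<times> q\<close> blocks \<open>B i j\<close>.\<close>

definition block_mat :: "nat \<Rightarrow> nat \<Rightarrow> nat \<Rightarrow> (nat \<Rightarrow> nat \<Rightarrow> complex mat) \<Rightarrow> complex mat" where
  "block_mat q r c B =
     mat (r * q) (c * q) (\<lambda>(i, j). B (i div q) (j div q) $$ (i mod q, j mod q))"

definition H1 :: "nat \<Rightarrow> (nat \<Rightarrow> complex mat) \<Rightarrow> nat \<Rightarrow> complex mat" where
  "H1 q s j = block_mat q (j + 1) (j + 1) (\<lambda>a b. s (a + b))"

definition H2 :: "nat \<Rightarrow> (nat \<Rightarrow> complex mat) \<Rightarrow> nat \<Rightarrow> complex mat" where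
  "H2 q s j = block_mat q (j + 1) (j + 1) (\<lambda>a b. s (a + b + 1))"

text \<open>Stieltjes positivity of the finite sequence \<open>s 0, \<dots>, s \<kappa>\<close>.\<close>

definition stieltjes_positive :: "nat \<Rightarrow> (nat \<Rightarrow> complex mat) \<Rightarrow> nat \<Rightarrow> bool" where
  "stieltjes_positive q s \<kappa> \<longleftrightarrow>
     (\<forall>j. 2 * j \<le> \<kappa> \<longrightarrow> hermitian_pos_def ((j + 1) * q) (H1 q s j)) \<and>
     (\<forall>j. 2 * j + 1 \<le> \<kappa> \<longrightarrow> hermitian_pos_def ((j + 1) * q) (H2 q s j))"

definition y_col :: "nat \<Rightarrow> (nat \<Rightarrow> complex mat) \<Rightarrow> nat \<Rightarrow> nat \<Rightarrow> complex mat" where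
  "y_col q s j k = mat_adjoint (block_mat q 1 (k + 1 - j) (\<lambda>_ b. s (j + b)))"

definition Y1 :: "nat \<Rightarrow> (nat \<Rightarrow> complex mat) \<Rightarrow> nat \<Rightarrow> complex mat" where
  "Y1 q s j = y_col q s j (2 * j - 1)"

definition Y2 :: "nat \<Rightarrow> (nat \<Rightarrow> complex mat) \<Rightarrow> nat \<Rightarrow> complex mat" where
  "Y2 q s j = y_col q s (j + 1) (2 * j)"


subsection \<open>The matrix polynomials P and Q\<close>

definition T_mat :: "nat \<Rightarrow> nat \<Rightarrow> complex mat" where
  "T_mat q j = four_block_mat (0\<^sub>m q (j * q)) (0\<^sub>m q q) (1\<^sub>m (j * q)) (0\<^sub>m (j * q) q)"

definition R_mat :: "nat \<Rightarrow> nat \<Rightarrow> complex \<Rightarrow> complex mat" where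
  "R_mat q j z = minv (1\<^sub>m ((j + 1) * q) - z \<cdot>\<^sub>m T_mat q j)"

definition v_col :: "nat \<Rightarrow> nat \<Rightarrow> complex mat" where
  "v_col q j = 1\<^sub>m q @\<^sub>r 0\<^sub>m (j * q) q"

definition u1_col :: "nat \<Rightarrow> (nat \<Rightarrow> complex mat) \<Rightarrow> nat \<Rightarrow> complex mat" where
  "u1_col q s j = 0\<^sub>m q q @\<^sub>r (- y_col q s 0 (j - 1))"

definition u2_col :: "nat \<Rightarrow> (nat \<Rightarrow> complex mat) \<Rightarrow> nat \<Rightarrow> complex mat" where
  "u2_col q s j = - y_col q s 0 j"

definition append_cols :: "complex mat \<Rightarrow> complex mat \<Rightarrow> complex mat" where
  "append_cols A B = four_block_mat A B (0\<^sub>m 0 (dim_col A)) (0\<^sub>m 0 (dim_col B))"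

text \<open>The block row \<open>(- Y\<^sup>* H\<^sup>-\<^sup>1, I)\<close>.\<close>

definition lead_row :: "nat \<Rightarrow> complex mat \<Rightarrow> complex mat \<Rightarrow> complex mat" where
  "lead_row q Y H = append_cols (- (mat_adjoint Y * minv H)) (1\<^sub>m q)"

definition P1 :: "nat \<Rightarrow> (nat \<Rightarrow> complex mat) \<Rightarrow> nat \<Rightarrow> complex \<Rightarrow> complex mat" where
  "P1 q s j z = (if j = 0 then 1\<^sub>m q
     else lead_row q (Y1 q s j) (H1 q s (j - 1)) * R_mat q j z * v_col q j)"

definition Q1 :: "nat \<Rightarrow> (nat \<Rightarrow> complex mat) \<Rightarrow> nat \<Rightarrow> complex \<Rightarrow> complex mat" where
  "Q1 q s j z = (if j = 0 then 0\<^sub>m q q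
     else - (lead_row q (Y1 q s j) (H1 q s (j - 1)) * R_mat q j z * u1_col q s j))"

definition P2 :: "nat \<Rightarrow> (nat \<Rightarrow> complex mat) \<Rightarrow> nat \<Rightarrow> complex \<Rightarrow> complex mat" where
  "P2 q s j z = (if j = 0 then 1\<^sub>m q
     else lead_row q (Y2 q s j) (H2 q s (j - 1)) * R_mat q j z * v_col q j)"

definition Q2 :: "nat \<Rightarrow> (nat \<Rightarrow> complex mat) \<Rightarrow> nat \<Rightarrow> complex \<Rightarrow> complex mat" where
  "Q2 q s j z = (if j = 0 then s 0
     else - (lead_row q (Y2 q s j) (H2 q s (j - 1)) * R_mat q j z * u2_col q s j))"

end

theory Submission
  imports Defs
begin

text \<open>
  Reading the representation entrywise, each entry of \<open>f\<close> is a scalar polynomial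
  \<open>p\<close> with \<open>p(z) = X(z\<^sup>2) + z Y(z\<^sup>2)\<close>, where \<open>X\<close> and \<open>Y\<close> are conjugated entries of the
  matrix functions in the representation, taken at the argument \<open>-cnj w\<close>. Replacing \<open>z\<close> by \<open>-z\<close>
  separates the two summands: \<open>X\<close> and \<open>Y\<close> have to be the polynomials formed by the even and the
  odd coefficients of \<open>p\<close>. Thus the representation itself forces the entries of \<open>P\<close> and \<open>Q\<close> to be
  polynomials, and the asserted formulas say that their coefficient of \<open>w\<^sup>j\<close> is the \<open>j\<close>-th
  derivative at \<open>0\<close> divided by \<open>j!\<close>; the factor \<open>(-1)\<^sup>j\<close> comes from the sign in \<open>-cnj w\<close>, and
  the two conjugations, of the argument and of the value, again give a polynomial in \<open>w\<close>
  (\<open>coeff_of_even_odd_representation\<close>, \<open>matpoly_coefficients\<close>).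

  One point needs the definition of these functions: the identity is blind to \<open>Y(0)\<close>, because the
  factor \<open>z\<close> vanishes there, while the derivatives are taken exactly at \<open>0\<close>. Continuity of \<open>Y\<close> at
  \<open>0\<close> fills the gap. It holds because \<open>I - z T\<close>, with \<open>T\<close> the nilpotent block shift, has the
  inverse \<open>I + z T + z\<^sup>2 T\<^sup>2 + \<dots>\<close>, a finite sum whose entries are \<open>0\<close> or powers of \<open>z\<close>
  (\<open>R_mat_eq\<close>).
\<close>

section \<open>Splitting a scalar polynomial into even and odd parts\<close>

lemma poly_even_odd_split:
  fixes p :: "'a :: comm_ring_1 poly"
  obtains e d where "\<And>z. poly p z = poly e (z\<^sup>2) + z * poly d (z\<^sup>2)"
    "\<And>j. coeff e j = coeff p (2 * j)" "\<And>j. coeff d j = coeff p (2 * j + 1)"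
proof -
  have "\<exists>e d. (\<forall>z. poly p z = poly e (z\<^sup>2) + z * poly d (z\<^sup>2)) \<and>
          (\<forall>j. coeff e j = coeff p (2 * j) \<and> coeff d j = coeff p (2 * j + 1))"
  proof (induction p)
    case 0
    show ?case by (intro exI[of _ 0]) simp
  next
    case (pCons a p)
    then obtain e d where e: "\<And>z. poly p z = poly e (z\<^sup>2) + z * poly d (z\<^sup>2)"
      "\<And>j. coeff e j = coeff p (2 * j)" "\<And>j. coeff d j = coeff p (2 * j + 1)" by blast
    \<comment> \<open>Multiplication by \<open>z\<close> turns the odd part into \<open>z\<^sup>2\<close> times an even part.\<close>
    show ?case
    proof (rule exI[of _ "pCons a d"], rule exI[of _ e], intro conjI allI)
      show "poly (pCons a p) z = poly (pCons a d) (z\<^sup>2) + z * poly e (z\<^sup>2)" for z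
        by (simp add: e(1) algebra_simps power2_eq_square)
      show "coeff (pCons a d) j = coeff (pCons a p) (2 * j)" for j
        by (cases j) (simp_all add: e)
      show "coeff e j = coeff (pCons a p) (2 * j + 1)" for j
        by (simp add: e)
    qed
  qed
  then show ?thesis using that by blast
qed

text \<open>Comparing the identity at the two square roots of \<open>w\<close> gives both parts for \<open>w \<noteq> 0\<close>. At
  \<open>w = 0\<close> it says nothing about \<open>Y\<close>, whose value there is recovered as a limit.\<close>

lemma even_odd_parts_unique:
  fixes X Y :: "complex \<Rightarrow> complex"
  assumes eq: "\<And>z. X (z\<^sup>2) + z * Y (z\<^sup>2) = poly e (z\<^sup>2) + z * poly d (z\<^sup>2)"
    and cont: "isCont Y 0"
  shows "X = poly e" and "Y = poly d"
proof -
  have plus: "X w + csqrt w * Y w = poly e w + csqrt w * poly d w" for w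
    using eq[of "csqrt w"] by simp
  have minus: "X w - csqrt w * Y w = poly e w - csqrt w * poly d w" for w
    using eq[of "- csqrt w"] by simp
  have "2 * X w = 2 * poly e w" for w
    using arg_cong2[of _ _ _ _ "(+)", OF plus[of w] minus[of w]] by simp
  then show "X = poly e" by auto
  have nz: "Y w = poly d w" if "w \<noteq> 0" for w
    using arg_cong2[of _ _ _ _ "(-)", OF plus[of w] minus[of w]] that by simp
  have "Y \<midarrow>0\<rightarrow> poly d 0"
  proof (rule Lim_transform_eventually)
    show "poly d \<midarrow>0\<rightarrow> poly d 0" by (metis isCont_def poly_isCont)
    show "\<forall>\<^sub>F w in at 0. poly d w = Y w"
      by (auto simp: eventually_at_filter nz)
  qed
  then have "Y 0 = poly d 0"
    using cont LIM_unique unfolding isCont_def by blast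
  with nz show "Y = poly d" by (metis ext)
qed

lemma higher_deriv_poly:
  fixes p :: "complex poly"
  shows "(deriv ^^ j) (poly p) = poly ((pderiv ^^ j) p)"
  by (induction j) (auto intro!: ext DERIV_imp_deriv poly_DERIV)

text \<open>The reflection \<open>w \<mapsto> -cnj w\<close> is an involution, so \<open>F\<close> can be solved for: it is the polynomial
  with the conjugated coefficients of \<open>e\<close>, alternating in sign and divided by \<open>cnj a\<close>. Its Taylor
  coefficients at \<open>0\<close> can then be read off, and conjugating them back gives those of \<open>e\<close>.\<close>

lemma poly_coeff_from_conjugate:
  assumes F: "\<And>w. poly e w = a * cnj (F (- cnj w))" and "a \<noteq> 0"
  shows "coeff e j = a * (-1) ^ j / fact j * cnj ((deriv ^^ j) F 0)"
proof -
  define r where "r = smult (cnj (1 / a)) (pcompose (map_poly cnj e) [:0, -1:])"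
  have "poly r w = F w" for w
    using F[of "- cnj w"] \<open>a \<noteq> 0\<close> by (simp add: r_def poly_pcompose)
  then have "F = poly r" by auto
  then have "(deriv ^^ j) F 0 = fact j * coeff r j"
    by (simp add: higher_deriv_poly poly_0_coeff_0 coeff_higher_pderiv pochhammer_fact)
  also have "coeff r j = cnj (1 / a) * ((-1) ^ j * cnj (coeff e j))"
    by (simp add: r_def coeff_pcompose_linear coeff_map_poly)
  finally show ?thesis using \<open>a \<noteq> 0\<close>
    by simp
qed

lemma coeff_of_even_odd_representation:
  fixes p :: "complex poly"
  assumes rep: "\<And>z. poly p z = a * cnj (F (- (cnj z)\<^sup>2)) + b * z * cnj (G (- (cnj z)\<^sup>2))"
    and "a \<noteq> 0" "b \<noteq> 0" and cont: "isCont G 0"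
  shows "coeff p (2 * j) = a * (-1) ^ j / fact j * cnj ((deriv ^^ j) F 0)"
    and "coeff p (2 * j + 1) = b * (-1) ^ j / fact j * cnj ((deriv ^^ j) G 0)"
proof -
  obtain e d where split: "\<And>z. poly p z = poly e (z\<^sup>2) + z * poly d (z\<^sup>2)"
    and e: "\<And>j. coeff e j = coeff p (2 * j)" and d: "\<And>j. coeff d j = coeff p (2 * j + 1)"
    by (rule poly_even_odd_split[of p]) blast
  have contY: "isCont (\<lambda>w. b * cnj (G (- cnj w))) 0"
  proof -
    have "isCont (\<lambda>w. G (- cnj w)) 0"
      by (rule isCont_o2[where g = G]) (use cont in \<open>auto intro!: continuous_intros\<close>)
    then show ?thesis by (intro continuous_intros)
  qed
  have parts: "a * cnj (F (- cnj (z\<^sup>2))) + z * (b * cnj (G (- cnj (z\<^sup>2))))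
      = poly e (z\<^sup>2) + z * poly d (z\<^sup>2)" for z
    using rep[of z] split[of z] by (simp add: mult_ac)
  note u = even_odd_parts_unique[of "\<lambda>w. a * cnj (F (- cnj w))" "\<lambda>w. b * cnj (G (- cnj w))",
      OF parts contY]
  show "coeff p (2 * j) = a * (-1) ^ j / fact j * cnj ((deriv ^^ j) F 0)"
    unfolding e[symmetric] by (rule poly_coeff_from_conjugate) (simp_all add: \<open>a \<noteq> 0\<close> fun_cong[OF u(1), symmetric])
  show "coeff p (2 * j + 1) = b * (-1) ^ j / fact j * cnj ((deriv ^^ j) G 0)"
    unfolding d[symmetric] by (rule poly_coeff_from_conjugate) (simp_all add: \<open>b \<noteq> 0\<close> fun_cong[OF u(2), symmetric])
qed

section \<open>Coefficients of a matrix polynomial\<close>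

lemma mat_adjoint_dim [simp]:
  "dim_row (mat_adjoint M) = dim_col M" "dim_col (mat_adjoint M) = dim_row M"
  by (auto simp: mat_adjoint_def)

lemma mat_adjoint_index [simp]:
  fixes M :: "complex mat"
  assumes "i < dim_col M" "j < dim_row M"
  shows "mat_adjoint M $$ (i, j) = cnj (M $$ (j, i))"
  using assms by (simp add: mat_adjoint_def mat_of_rows_def)

lemma matpoly_entry_poly:
  assumes "a < q" "b < q"
  obtains p where "\<And>z. poly p z = matpoly q n A z $$ (a, b)"
    and "\<And>k. k \<le> n \<Longrightarrow> coeff p k = A (n - k) $$ (a, b)"
proof
  let ?p = "\<Sum>i\<le>n. monom (A i $$ (a, b)) (n - i)"
  show "poly ?p z = matpoly q n A z $$ (a, b)" for z
    using assms by (simp add: matpoly_def poly_sum poly_monom)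
  show "coeff ?p k = A (n - k) $$ (a, b)" if "k \<le> n" for k
  proof -
    have "coeff ?p k = (\<Sum>i\<le>n. if i = n - k then A i $$ (a, b) else 0)"
      unfolding coeff_sum using that by (intro sum.cong) auto
    then show ?thesis by simp
  qed
qed

text \<open>The parameters \<open>x\<close> and \<open>y\<close> carry the signs, so that this covers both parities of \<open>n\<close>. Here
  \<open>F\<close> is the function giving the coefficients of even powers and \<open>G\<close> the one giving those of odd
  powers. The adjoint transposes, so entry \<open>(a, b)\<close> of the coefficient comes from entry \<open>(b, a)\<close> of
  \<open>F\<close> or \<open>G\<close>.\<close>

lemma matpoly_coefficients:
  assumes A: "\<And>j. j \<le> n \<Longrightarrow> A j \<in> carrier_mat q q"
    and rep: "\<And>z. matpoly q n A z =
      x \<cdot>\<^sub>m (mat_adjoint (F (- (cnj z)\<^sup>2)) + (y * z) \<cdot>\<^sub>m mat_adjoint (G (- (cnj z)\<^sup>2)))"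
    and F: "\<And>w. F w \<in> carrier_mat q q" and G: "\<And>w. G w \<in> carrier_mat q q"
    and cont: "\<And>a b. a < q \<Longrightarrow> b < q \<Longrightarrow> isCont (\<lambda>w. G w $$ (a, b)) 0"
    and "x \<noteq> 0" "y \<noteq> 0"
  shows "2 * j \<le> n \<Longrightarrow>
      A (n - 2 * j) = (x * (-1) ^ j / fact j) \<cdot>\<^sub>m mat_adjoint (matderiv q j F 0)"
    and "2 * j + 1 \<le> n \<Longrightarrow>
      A (n - (2 * j + 1)) = (x * y * (-1) ^ j / fact j) \<cdot>\<^sub>m mat_adjoint (matderiv q j G 0)"
proof -
  have entry: "(2 * j \<le> n \<longrightarrow> A (n - 2 * j) $$ (a, b) =
        x * (-1) ^ j / fact j * cnj ((deriv ^^ j) (\<lambda>w. F w $$ (b, a)) 0)) \<and>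
      (2 * j + 1 \<le> n \<longrightarrow> A (n - (2 * j + 1)) $$ (a, b) =
        x * y * (-1) ^ j / fact j * cnj ((deriv ^^ j) (\<lambda>w. G w $$ (b, a)) 0))"
    if ab: "a < q" "b < q" for a b
  proof -
    obtain p where p: "\<And>z. poly p z = matpoly q n A z $$ (a, b)"
      and cp: "\<And>k. k \<le> n \<Longrightarrow> coeff p k = A (n - k) $$ (a, b)"
      using matpoly_entry_poly[OF ab] by blast
    have dims: "dim_row (F w) = q" "dim_col (F w) = q" "dim_row (G w) = q" "dim_col (G w) = q" for w
      using F[of w] G[of w] by auto
    have "poly p z = x * cnj (F (- (cnj z)\<^sup>2) $$ (b, a))
        + x * y * z * cnj (G (- (cnj z)\<^sup>2) $$ (b, a))" for z
      using ab by (simp add: p rep dims algebra_simps)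
    from coeff_of_even_odd_representation[OF this _ _ cont[OF ab(2,1)], of j]
    show ?thesis using \<open>x \<noteq> 0\<close> \<open>y \<noteq> 0\<close> by (auto simp flip: cp)
  qed
  show "A (n - 2 * j) = (x * (-1) ^ j / fact j) \<cdot>\<^sub>m mat_adjoint (matderiv q j F 0)"
    if "2 * j \<le> n"
    using A[of "n - 2 * j"] entry that by (intro eq_matI) (auto simp: matderiv_def)
  show "A (n - (2 * j + 1)) = (x * y * (-1) ^ j / fact j) \<cdot>\<^sub>m mat_adjoint (matderiv q j G 0)"
    if "2 * j + 1 \<le> n"
    using A[of "n - (2 * j + 1)"] entry that by (intro eq_matI) (auto simp: matderiv_def)
qed

section \<open>The resolvent of the block shift\<close>

lemma minv_eqI:
  assumes M: "M \<in> carrier_mat n n" and N: "N \<in> carrier_mat n n" and MN: "M * N = 1\<^sub>m n"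
  shows "minv M = N"
proof -
  have "M \<in> Units (ring_mat TYPE(complex) n ())"
    using M N MN mat_mult_left_right_inverse[OF M N MN] by (auto simp: Units_def ring_mat_def)
  then obtain B where "mat_inverse M = Some B"
    using mat_inverse(1)[OF M, of "()"] by fastforce
  moreover from mat_inverse(2)[OF M this] have B: "B * M = 1\<^sub>m n" "B \<in> carrier_mat n n" by auto
  have "B = B * (M * N)" using B MN by simp
  also have "\<dots> = N" using B M N by (simp flip: assoc_mult_mat)
  finally show ?thesis using \<open>mat_inverse M = Some B\<close> by simp
qed

lemma T_mat_eq: "T_mat q j = mat ((j + 1) * q) ((j + 1) * q) (\<lambda>(i, k). if i = k + q then 1 else 0)"
  by (rule eq_matI) (auto simp: T_mat_def four_block_mat_def Let_def)

text \<open>This is the terminating Neumann series of \<open>(I - z T)\<^sup>-\<^sup>1\<close>: the power \<open>T\<^sup>l\<close> has its ones exactly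
  where the row index exceeds the column index by \<open>l q\<close>.\<close>

lemma R_mat_eq:
  assumes "q > 0"
  shows "R_mat q j z = mat ((j + 1) * q) ((j + 1) * q)
    (\<lambda>(i, k). if k \<le> i \<and> q dvd i - k then z ^ ((i - k) div q) else 0)"
proof -
  define N where "N = mat ((j + 1) * q) ((j + 1) * q)
    (\<lambda>(i, k). if k \<le> i \<and> q dvd i - k then z ^ ((i - k) div q) else 0)"
  let ?n = "(j + 1) * q"
  have T: "T_mat q j \<in> carrier_mat ?n ?n" and N: "N \<in> carrier_mat ?n ?n"
    by (auto simp: T_mat_eq N_def)
  have TN: "(T_mat q j * N) $$ (i, k) = (if q \<le> i then N $$ (i - q, k) else 0)"
    if ik: "i < ?n" "k < ?n" for i k
  proof -
    have "(T_mat q j * N) $$ (i, k) = (\<Sum>l<?n. (if i = l + q then 1 else 0) * N $$ (l, k))"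
      using ik N by (auto simp: T_mat_eq scalar_prod_def lessThan_atLeast0 intro!: sum.cong)
    also have "\<dots> = (\<Sum>l<?n. if l = i - q then (if q \<le> i then N $$ (l, k) else 0) else 0)"
      by (intro sum.cong) auto
    also have "\<dots> = (if q \<le> i then N $$ (i - q, k) else 0)"
      using ik by (auto simp: sum.delta)
    finally show ?thesis .
  qed
  have "(1\<^sub>m ?n - z \<cdot>\<^sub>m T_mat q j) * N = N - z \<cdot>\<^sub>m (T_mat q j * N)"
    using T N by (simp add: minus_mult_distrib_mat[of _ ?n ?n _ _ ?n] mult_smult_assoc_mat[of _ ?n ?n _ ?n])
  also have "\<dots> = 1\<^sub>m ?n"
  proof (rule eq_matI)
    fix i k assume "i < dim_row (1\<^sub>m ?n :: complex mat)" "k < dim_col (1\<^sub>m ?n :: complex mat)"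
    then have ik: "i < ?n" "k < ?n" by auto
    \<comment> \<open>From \<open>q\<close> rows below the diagonal on, one row block up in \<open>N\<close> lowers the exponent of \<open>z\<close>
      by one, so the terms cancel; closer to the diagonal only the diagonal entries survive.\<close>
    have "N $$ (i, k) - z * (if q \<le> i then N $$ (i - q, k) else 0) = (if i = k then 1 else 0)"
    proof (cases "k + q \<le> i")
      case True
      then obtain l where l: "i = k + q + l" using le_Suc_ex by blast
      then show ?thesis using ik assms by (simp add: N_def)
    next
      case False
      then have "k \<le> i \<and> q dvd i - k \<longleftrightarrow> i = k"
        using dvd_imp_le[of q "i - k"] by fastforce
      then show ?thesis using ik False by (auto simp: N_def)
    qed
    then show "(N - z \<cdot>\<^sub>m (T_mat q j * N)) $$ (i, k) = 1\<^sub>m ?n $$ (i, k)"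
      using ik T N by (simp add: TN del: index_mult_mat(1))
  qed (use T N in auto)
  finally have inv: "(1\<^sub>m ?n - z \<cdot>\<^sub>m T_mat q j) * N = 1\<^sub>m ?n" .
  have "1\<^sub>m ?n - z \<cdot>\<^sub>m T_mat q j \<in> carrier_mat ?n ?n"
    using T by (intro minus_carrier_mat smult_carrier_mat)
  then have "R_mat q j z = N"
    unfolding R_mat_def by (rule minv_eqI[OF _ N inv])
  then show ?thesis by (simp only: N_def)
qed

lemma isCont_resolvent_entry:
  assumes "q > 0" and U: "dim_row U = (j + 1) * q" and "a < dim_row L" "b < dim_col U"
  shows "isCont (\<lambda>z. (L * R_mat q j z * U) $$ (a, b)) w"
proof -
  let ?n = "(j + 1) * q"
  define E where "E = (\<lambda>z i k. if k \<le> i \<and> q dvd i - k then z ^ ((i - k) div q) else (0::complex))"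
  have "(L * R_mat q j z * U) $$ (a, b) =
      (\<Sum>l<?n. (\<Sum>i<?n. row L a $ i * E z i l) * U $$ (l, b))" for z
    using assms by (simp add: R_mat_eq scalar_prod_def lessThan_atLeast0 E_def)
  moreover have "isCont (\<lambda>z. E z i k) w" for i k
    unfolding E_def by (cases "k \<le> i \<and> q dvd i - k") (auto intro!: continuous_intros)
  ultimately show ?thesis by (simp add: continuous_intros)
qed

section \<open>Sizes and continuity of \<open>P\<close> and \<open>Q\<close>\<close>

lemma lead_row_dim_row [simp]: "dim_row (lead_row q (y_col q s i k) H) = q"
  by (simp add: lead_row_def append_cols_def y_col_def block_mat_def)

lemma P_carrier: "P1 q s j z \<in> carrier_mat q q" "P2 q s j z \<in> carrier_mat q q"
  by (auto simp: P1_def P2_def Y1_def Y2_def v_col_def append_rows_def intro!: carrier_matI)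

lemma u_col_dims:
  "j > 0 \<Longrightarrow> dim_row (u1_col q s j) = (j + 1) * q" "dim_col (u1_col q s j) = q"
  "dim_row (u2_col q s j) = (j + 1) * q" "dim_col (u2_col q s j) = q"
  by (auto simp: u1_col_def u2_col_def append_rows_def y_col_def block_mat_def)

lemma Q_carrier:
  "Q1 q s j z \<in> carrier_mat q q"
  "s 0 \<in> carrier_mat q q \<Longrightarrow> Q2 q s j z \<in> carrier_mat q q"
  by (auto simp: Q1_def Q2_def Y1_def Y2_def u_col_dims intro!: carrier_matI)

text \<open>\<open>Q1\<close> for even degree and \<open>P2\<close> for odd degree are the functions multiplied by \<open>z\<close> in the
  representation, so their values at \<open>0\<close> are the ones that have to be recovered by continuity.\<close>

lemma isCont_Q1_entry:
  assumes "q > 0" "a < q" "b < q"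
  shows "isCont (\<lambda>z. Q1 q s j z $$ (a, b)) w"
  using assms isCont_resolvent_entry[of q "u1_col q s j" j a _ b]
  by (cases "j = 0") (auto simp: Q1_def Y1_def u_col_dims intro!: continuous_minus)

lemma isCont_P2_entry:
  assumes "q > 0" "a < q" "b < q"
  shows "isCont (\<lambda>z. P2 q s j z $$ (a, b)) w"
  using assms isCont_resolvent_entry[of q "v_col q j" j a _ b]
  by (cases "j = 0") (auto simp: P2_def Y2_def v_col_def append_rows_def)

section \<open>The coefficients of \<open>f\<close>\<close>

theorem lemma4p1:
  fixes q n :: nat and A s :: "nat \<Rightarrow> complex mat"
  assumes "q \<ge> 1" and "n \<ge> 1"
    and "\<And>j. j \<le> n \<Longrightarrow> A j \<in> carrier_mat q q"
    and "A 0 = 1\<^sub>m q"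
    and "htm_polynomial q n A"
    and "markov_parameters q n A s"
    and "stieltjes_positive q s (n - 1)"
    and "\<And>m z. n = 2 * m \<Longrightarrow> matpoly q n A z =
           (-1) ^ m \<cdot>\<^sub>m (mat_adjoint (P1 q s m (- (cnj z)\<^sup>2)) - z \<cdot>\<^sub>m mat_adjoint (Q1 q s m (- (cnj z)\<^sup>2)))"
    and "\<And>m z. n = 2 * m + 1 \<Longrightarrow> matpoly q n A z =
           (-1) ^ m \<cdot>\<^sub>m (mat_adjoint (Q2 q s m (- (cnj z)\<^sup>2)) + z \<cdot>\<^sub>m mat_adjoint (P2 q s m (- (cnj z)\<^sup>2)))"
  shows "(\<forall>m. n = 2 * m \<longrightarrow>
           (\<forall>k j. k = 2 * j \<and> j \<le> m \<longrightarrow>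
              A (n - k) = ((-1) ^ (m + j) / fact j) \<cdot>\<^sub>m mat_adjoint (matderiv q j (P1 q s m) 0)) \<and>
           (\<forall>k j. k = 2 * j + 1 \<and> j \<le> m - 1 \<longrightarrow>
              A (n - k) = (- ((-1) ^ (m + j) / fact j)) \<cdot>\<^sub>m mat_adjoint (matderiv q j (Q1 q s m) 0))) \<and>
         (\<forall>m. n = 2 * m + 1 \<longrightarrow>
           (\<forall>k j. k = 2 * j \<and> j \<le> m \<longrightarrow>
              A (n - k) = ((-1) ^ (m + j) / fact j) \<cdot>\<^sub>m mat_adjoint (matderiv q j (Q2 q s m) 0)) \<and>
           (\<forall>k j. k = 2 * j + 1 \<and> j \<le> m \<longrightarrow>
              A (n - k) = ((-1) ^ (m + j) / fact j) \<cdot>\<^sub>m mat_adjoint (matderiv q j (P2 q s m) 0)))"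
proof (intro conjI allI impI; elim conjE)
  have q: "q > 0" using assms(1) by simp
  have s0: "s 0 \<in> carrier_mat q q" using assms(6) by (simp add: markov_parameters_def)
  {
    fix m assume n: "n = 2 * m"
    have "matpoly q n A z = (-1) ^ m \<cdot>\<^sub>m (mat_adjoint (P1 q s m (- (cnj z)\<^sup>2))
        + (-1 * z) \<cdot>\<^sub>m mat_adjoint (Q1 q s m (- (cnj z)\<^sup>2)))" for z
      using P_carrier(1)[of q s m "- (cnj z)\<^sup>2"] Q_carrier(1)[of q s m "- (cnj z)\<^sup>2"]
      unfolding assms(8)[OF n] by (intro eq_matI) auto
    note coeffs = matpoly_coefficients[OF assms(3) this P_carrier(1) Q_carrier(1) isCont_Q1_entry[OF q]]
    show "A (n - k) = ((-1) ^ (m + j) / fact j) \<cdot>\<^sub>m mat_adjoint (matderiv q j (P1 q s m) 0)"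
      if "k = 2 * j" "j \<le> m" for k j
      using coeffs(1)[of j] that n by (simp add: power_add)
    show "A (n - k) = (- ((-1) ^ (m + j) / fact j)) \<cdot>\<^sub>m mat_adjoint (matderiv q j (Q1 q s m) 0)"
      if "k = 2 * j + 1" "j \<le> m - 1" for k j
      \<comment> \<open>As \<open>n \<ge> 1\<close> forces \<open>m \<ge> 1\<close>, the difference \<open>m - 1\<close> is not truncated and \<open>k < n\<close>.\<close>
      using coeffs(2)[of j] that n assms(2) by (simp add: power_add)
  next
    fix m assume n: "n = 2 * m + 1"
    have "matpoly q n A z = (-1) ^ m \<cdot>\<^sub>m (mat_adjoint (Q2 q s m (- (cnj z)\<^sup>2))
        + (1 * z) \<cdot>\<^sub>m mat_adjoint (P2 q s m (- (cnj z)\<^sup>2)))" for z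
      using assms(9)[OF n] by simp
    note coeffs = matpoly_coefficients[OF assms(3) this Q_carrier(2)[of s, OF s0] P_carrier(2) isCont_P2_entry[OF q]]
    show "A (n - k) = ((-1) ^ (m + j) / fact j) \<cdot>\<^sub>m mat_adjoint (matderiv q j (Q2 q s m) 0)"
      if "k = 2 * j" "j \<le> m" for k j
      using coeffs(1)[of j] that n by (simp add: power_add)
    show "A (n - k) = ((-1) ^ (m + j) / fact j) \<cdot>\<^sub>m mat_adjoint (matderiv q j (P2 q s m) 0)"
      if "k = 2 * j + 1" "j \<le> m" for k j
      using coeffs(2)[of j] that n by (simp add: power_add)
  }
qed

end
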